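(* Let $X$ be a Banach space (not necessarily reflexive), let $u_0\in X$, and let $F:X\to X$ be a twice Fréchet differentiable map such that for every $R>0$ there are finite constants $M_1(R),M_2(R)$ with $$\sup_{u\in B(u_0,R)}\|F^{(j)}(u)\|\le M_j(R),\qquad j=1,2.$$ Assume that there are constants $c>0$, $0<k\le 1$ and $\varepsilon_0>0$ such that for every $u\in X$ and every $\varepsilon\in(0,\varepsilon_0)$ the operator $F'(u)+\varepsilon I$ is boundedly invertible and $$\|(F'(u)+\varepsilon I)^{-1}\|\le c\,\varepsilon^{-k}.$$ Let $\varepsilon\in(0,\varepsilon_0)$ and let $w_0\in X$ be arbitrary. Then the Cauchy problem $$\dot w(t)=-\bigl(F'(w(t))+\varepsilon I\bigr)^{-1}\bigl[F(w(t))+\varepsilon w(t)\bigr],\qquad w(0)=w_0,$$ has a unique global solution $w:[0,\infty)\to X$, the limit $w(\infty):=\lim_{t\to\infty}w(t)$ exists in $X$, and $$F(w(\infty))+\varepsilon w(\infty)=0.$$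
   Context: $B(u_0,R):=\{u\in X:\|u-u_0\|\le R\}$. $F^{(j)}(u)$ is the $j$-th Fréchet derivative of $F$ at $u$, with $F'=F^{(1)}$, and its norm is the usual norm of bounded ($j$-linear) operators. $I$ is the identity operator on $X$. $\dot w=dw/dt$ is the strong (norm) derivative, and limits are in the norm of $X$. *)

theory Defs
  imports "HOL-Analysis.Analysis"
begin

definition is_blinfun_inverse ::
    "('a::real_normed_vector \<Rightarrow>\<^sub>L 'a) \<Rightarrow> ('a \<Rightarrow>\<^sub>L 'a) \<Rightarrow> bool" where
  "is_blinfun_inverse A B \<longleftrightarrow>
     A o\<^sub>L B = id_blinfun \<and> B o\<^sub>L A = id_blinfun"

definition boundedly_invertible :: "('a::real_normed_vector \<Rightarrow>\<^sub>L 'a) \<Rightarrow> bool" where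
  "boundedly_invertible A \<longleftrightarrow> (\<exists>B. is_blinfun_inverse A B)"

text \<open>The two-sided bounded inverse is unique when it exists; the value is
  unspecified for operators that are not boundedly invertible.\<close>

definition blinfun_inv ::
    "('a::real_normed_vector \<Rightarrow>\<^sub>L 'a) \<Rightarrow> ('a \<Rightarrow>\<^sub>L 'a)" where
  "blinfun_inv A = (THE B. is_blinfun_inverse A B)"

text \<open>A global solution on \<open>[0,\<infinity>)\<close> of the autonomous Cauchy problem
  \<open>w' = G w\<close>, \<open>w 0 = w0\<close>; the derivative is a norm derivative, one-sided at
  \<open>t = 0\<close>. Values of \<open>w\<close> at negative times are irrelevant.\<close>

definition global_solution ::
    "('a::real_normed_vector \<Rightarrow> 'a) \<Rightarrow> 'a \<Rightarrow> (real \<Rightarrow> 'a) \<Rightarrow> bool" where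
  "global_solution G w0 w \<longleftrightarrow>
     w 0 = w0 \<and>
     (\<forall>t\<ge>0. (w has_vector_derivative G (w t)) (at t within {0..}))"

end

theory Submission
  imports Defs
begin

text \<open>Put \<open>\<Phi> u = F u + \<epsilon> u\<close>, \<open>A u = F' u + \<epsilon> I\<close> and \<open>B u\<close> for the inverse of \<open>A u\<close>. Along every
  solution \<open>\<Phi> (w t) = e\<^sup>-\<^sup>t \<Phi> w\<^sub>0\<close>, so the equation reads \<open>w' = - e\<^sup>-\<^sup>t B w (\<Phi> w\<^sub>0)\<close>, and the substitution
  \<open>s = 1 - e\<^sup>-\<^sup>t\<close> turns it into \<open>y' = - B y (\<Phi> w\<^sub>0)\<close> on the compact interval \<open>[0,1]\<close>. The new right-hand
  side is bounded and is Lipschitz on bounded sets, so \<open>y\<close> exists on all of \<open>[0,1]\<close>;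
  moreover \<open>\<Phi> (y s) = (1 - s) \<Phi> w\<^sub>0\<close>, and \<open>w(\<infinity>) = y 1\<close>.\<close>

section \<open>Growth estimates and Picard iteration\<close>

lemma norm_increment_le:
  fixes f :: "real \<Rightarrow> 'a::real_normed_vector" and \<phi> \<phi>' :: "real \<Rightarrow> real"
  assumes "a \<le> b"
    and f: "\<And>t. t \<in> {a..b} \<Longrightarrow> (f has_vector_derivative f' t) (at t within {a..b})"
    and \<phi>: "\<And>t. t \<in> {a..b} \<Longrightarrow> (\<phi> has_real_derivative \<phi>' t) (at t)"
    and le: "\<And>t. t \<in> {a..b} \<Longrightarrow> norm (f' t) \<le> \<phi>' t"
  shows "norm (f b - f a) \<le> \<phi> b - \<phi> a"
proof (cases "a = b")
  case False
  show ?thesis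
  proof (rule differentiable_bound_general)
    show "a < b" using False assms(1) by simp
    show "continuous_on {a..b} f"
      using f by (meson continuous_on_eq_continuous_within has_vector_derivative_continuous)
    show "continuous_on {a..b} \<phi>"
      using \<phi> by (meson DERIV_isCont continuous_at_imp_continuous_on)
    fix t assume t: "a < t" "t < b"
    show "(f has_vector_derivative f' t) (at t)"
      using f[of t] t by (simp add: at_within_Icc_at)
    show "(\<phi> has_vector_derivative \<phi>' t) (at t)"
      using \<phi>[of t] t by (simp add: has_real_derivative_iff_has_vector_derivative)
    show "norm (f' t) \<le> \<phi>' t" using le t by simp
  qed
qed simp

text \<open>These are the comparison functions of the iterated Gronwall estimate: each one is an
  antiderivative of \<open>L\<close> times its predecessor, and all those with index
  \<open>Suc n\<close> vanish at 0. They serve both uniqueness and the convergence of the Picard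
  iterates.\<close>

lemma has_real_derivative_power_div_fact:
  "((\<lambda>t. C * (L * t) ^ Suc n / fact (Suc n)) has_real_derivative
      L * (C * (L * t) ^ n / fact n)) (at t)"
proof -
  have "((\<lambda>t. L * t) has_real_derivative L) (at t)"
    by (auto intro!: derivative_eq_intros)
  from DERIV_cdivide[OF DERIV_cmult[OF DERIV_power_Suc[OF this, of n], of C], of "fact (Suc n)"]
  show ?thesis
    by (rule DERIV_cong) (simp add: divide_simps)
qed

text \<open>Integrating the differential inequality \<open>n\<close> times from 0 improves a crude
  bound \<open>C\<close> for \<open>d\<close> to \<open>C * (L * T) ^ n / fact n\<close> at
  \<open>T\<close>, and this tends to 0.\<close>

lemma zero_if_norm_derivative_le:
  fixes d :: "real \<Rightarrow> 'a::real_normed_vector"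
  assumes "0 \<le> T" "0 \<le> L" "d 0 = 0"
    and d: "\<And>t. t \<in> {0..T} \<Longrightarrow> (d has_vector_derivative d' t) (at t within {0..T})"
    and le: "\<And>t. t \<in> {0..T} \<Longrightarrow> norm (d' t) \<le> L * norm (d t)"
  shows "d T = 0"
proof -
  have "continuous_on {0..T} d"
    using d by (meson continuous_on_eq_continuous_within has_vector_derivative_continuous)
  then have "bounded (d ` {0..T})"
    by (simp add: compact_continuous_image compact_imp_bounded)
  then obtain C where C: "\<And>t. t \<in> {0..T} \<Longrightarrow> norm (d t) \<le> C"
    unfolding bounded_iff by blast
  have *: "norm (d t) \<le> C * (L * t) ^ n / fact n" if "t \<in> {0..T}" for t n
    using that
  proof (induction n arbitrary: t)
    case 0
    then show ?case using C by simp
  next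
    case (Suc n)
    have "norm (d t - d 0) \<le> C * (L * t) ^ Suc n / fact (Suc n) - C * (L * 0) ^ Suc n / fact (Suc n)"
    proof (rule norm_increment_le[OF _ _ has_real_derivative_power_div_fact])
      fix s assume s: "s \<in> {0..t}"
      show "(d has_vector_derivative d' s) (at s within {0..t})"
        using d[of s] s Suc.prems by (auto intro: has_vector_derivative_within_subset)
      have "norm (d' s) \<le> L * norm (d s)" using le s Suc.prems by auto
      also have "\<dots> \<le> L * (C * (L * s) ^ n / fact n)"
        using s Suc.prems by (intro mult_left_mono Suc.IH \<open>0 \<le> L\<close>) auto
      finally show "norm (d' s) \<le> L * (C * (L * s) ^ n / fact n)" .
    qed (use Suc.prems in auto)
    then show ?case using \<open>d 0 = 0\<close> by simp
  qed
  have "(\<lambda>n. (L * T) ^ n / fact n) \<longlonglongrightarrow> 0"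
    using summable_LIMSEQ_zero[OF summable_exp[of "L * T"]] by (simp add: field_simps)
  then have "(\<lambda>n. C * ((L * T) ^ n / fact n)) \<longlonglongrightarrow> C * 0"
    by (rule tendsto_mult_left)
  then have "norm (d T) \<le> C * 0"
    using * \<open>0 \<le> T\<close> by (intro LIMSEQ_le_const) auto
  then show ?thesis by simp
qed

text \<open>Picard iteration. The speed bound and \<open>M * T \<le> R\<close> confine all iterates
  to the ball where \<open>g\<close> is Lipschitz, and the factorials in the difference bounds give
  uniform convergence on the whole interval, however large \<open>L * T\<close> is.\<close>

lemma autonomous_ode_solution_exists:
  fixes g :: "'a::banach \<Rightarrow> 'a"
  assumes lip: "L-lipschitz_on (cball x0 R) g"
    and bd: "\<And>x. x \<in> cball x0 R \<Longrightarrow> norm (g x) \<le> M"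
    and "0 \<le> T" "0 \<le> M" "M * T \<le> R"
  obtains y where "y 0 = x0" "\<And>t. t \<in> {0..T} \<Longrightarrow> y t \<in> cball x0 R"
    "\<And>t. t \<in> {0..T} \<Longrightarrow> (y has_vector_derivative g (y t)) (at t within {0..T})"
proof -
  have "0 \<le> L" using lip by (rule lipschitz_on_nonneg)
  have "0 \<le> R" using mult_nonneg_nonneg[OF \<open>0 \<le> M\<close> \<open>0 \<le> T\<close>] \<open>M * T \<le> R\<close> by linarith
  define Y :: "nat \<Rightarrow> real \<Rightarrow> 'a" where "Y = rec_nat (\<lambda>t. x0) (\<lambda>_ z t. x0 + integral {0..t} (\<lambda>s. g (z s)))"
  have Y0: "Y 0 t = x0" for t by (simp add: Y_def)
  have YS: "Y (Suc n) t = x0 + integral {0..t} (\<lambda>s. g (Y n s))" for n t by (simp add: Y_def)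
  have Y_init: "Y n 0 = x0" for n 
  proof (cases n)
    case (Suc m)
    then show ?thesis using integral_refl[of "0::real" "\<lambda>s. g (Y m s)"] by (simp add: YS)
  qed (simp add: Y0)
  have step: "(Y (Suc n) has_vector_derivative g (Y n t)) (at t within {0..T})"
    if "continuous_on {0..T} (Y n)" "Y n ` {0..T} \<subseteq> cball x0 R" "t \<in> {0..T}" for n t
  proof -
    have "continuous_on {0..T} (\<lambda>s. g (Y n s))"
      by (rule continuous_on_compose2[OF lipschitz_on_continuous_on[OF lip]]) (use that in auto)
    then show ?thesis
      unfolding YS using that(3)
      by (auto intro!: derivative_eq_intros integral_has_vector_derivative)
  qed
  have sub: "(f has_vector_derivative f') (at s within {0..t})"
    if "(f has_vector_derivative f') (at s within {0..T})" "t \<le> T"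
    for f :: "real \<Rightarrow> 'a" and f' s t
    using that by (auto intro: has_vector_derivative_within_subset)
  \<comment> \<open>Both halves of the invariant feed \<open>step\<close>: they make the integrand
    defining the next iterate continuous. The next iterate then moves with speed at most
    \<open>M\<close>, so by time \<open>T\<close> it is at distance at most \<open>R\<close> from
    \<open>x0\<close>.\<close>
  have inv: "continuous_on {0..T} (Y n) \<and> Y n ` {0..T} \<subseteq> cball x0 R" for n
  proof (induction n)
    case 0
    show ?case using \<open>0 \<le> R\<close> by (auto simp: Y0)
  next
    case (Suc n)
    note st = step[OF conjunct1[OF Suc] conjunct2[OF Suc]]
    have "Y (Suc n) t \<in> cball x0 R" if t: "t \<in> {0..T}" for t
    proof -
      have "norm (Y (Suc n) t - Y (Suc n) 0) \<le> M * t - M * 0"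
      proof (rule norm_increment_le)
        fix s assume "s \<in> {0..t}"
        with t have s: "s \<in> {0..T}" by auto
        show "(Y (Suc n) has_vector_derivative g (Y n s)) (at s within {0..t})"
          using st[OF s] t by (auto intro: sub)
        show "norm (g (Y n s)) \<le> M" using Suc s by (intro bd) blast
      qed (use t in \<open>auto intro!: derivative_eq_intros\<close>)
      also have "\<dots> \<le> M * T" using t \<open>0 \<le> M\<close> by (simp add: mult_left_mono)
      finally show ?thesis using \<open>M * T \<le> R\<close> Y_init by (simp add: dist_norm norm_minus_commute)
    qed
    moreover have "continuous_on {0..T} (Y (Suc n))"
      using st by (meson continuous_on_eq_continuous_within has_vector_derivative_continuous)
    ultimately show ?case by auto
  qed
  have Yin: "Y n t \<in> cball x0 R" if "t \<in> {0..T}" for n t using inv that by blast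
  have Yder: "(Y (Suc n) has_vector_derivative g (Y n t)) (at t within {0..T})"
    if "t \<in> {0..T}" for n t using step inv that by blast
  \<comment> \<open>The factor \<open>R\<close> comes from the base case, where \<open>Y 0\<close>
    is the centre of the ball and \<open>Y 1\<close> lies in it; each further step integrates the
    Lipschitz estimate for \<open>g\<close>.\<close>
  have diff: "norm (Y (Suc n) t - Y n t) \<le> R * (L * t) ^ n / fact n" if "t \<in> {0..T}" for n t
    using that
  proof (induction n arbitrary: t)
    case 0
    then show ?case using Yin[of t 1] by (simp add: Y0 dist_norm norm_minus_commute)
  next
    case (Suc n)
    let ?d = "\<lambda>t. Y (Suc (Suc n)) t - Y (Suc n) t"
    have "norm (?d t - ?d 0) \<le> R * (L * t) ^ Suc n / fact (Suc n) - R * (L * 0) ^ Suc n / fact (Suc n)"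
    proof (rule norm_increment_le[OF _ _ has_real_derivative_power_div_fact])
      fix s assume s': "s \<in> {0..t}"
      with Suc.prems have s: "s \<in> {0..T}" by auto
      show "(?d has_vector_derivative g (Y (Suc n) s) - g (Y n s)) (at s within {0..t})"
        using Suc.prems s by (auto intro!: sub has_vector_derivative_diff Yder)
      have "norm (g (Y (Suc n) s) - g (Y n s)) \<le> L * norm (Y (Suc n) s - Y n s)"
        by (intro lipschitz_on_normD[OF lip] Yin s)
      also have "\<dots> \<le> L * (R * (L * s) ^ n / fact n)"
        by (intro mult_left_mono Suc.IH \<open>0 \<le> L\<close> s)
      finally show "norm (g (Y (Suc n) s) - g (Y n s)) \<le> L * (R * (L * s) ^ n / fact n)" .
    qed (use Suc.prems in auto)
    then show ?case by (simp add: Y_init)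
  qed
  \<comment> \<open>The limit of the iterates is written as a telescoping series, so that the
    Weierstrass test applies with a multiple of the exponential series as majorant.\<close>
  define y where "y t = x0 + (\<Sum>i. Y (Suc i) t - Y i t)" for t
  have ser: "uniform_limit {0..T} (\<lambda>n t. \<Sum>i<n. Y (Suc i) t - Y i t)
      (\<lambda>t. \<Sum>i. Y (Suc i) t - Y i t) sequentially"
  proof (rule Weierstrass_m_test)
    show "norm (Y (Suc n) t - Y n t) \<le> R * ((L * T) ^ n / fact n)" if "t \<in> {0..T}" for n t
    proof -
      have "R * ((L * t) ^ n / fact n) \<le> R * ((L * T) ^ n / fact n)"
        using that \<open>0 \<le> L\<close> \<open>0 \<le> R\<close>
        by (intro mult_left_mono divide_right_mono power_mono) auto
      with diff[OF that, of n] show ?thesis by simp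
    qed
    show "summable (\<lambda>n. R * ((L * T) ^ n / fact n))"
      using summable_exp[of "L * T"] by (intro summable_mult) (simp add: field_simps)
  qed
  have "uniform_limit {0..T} (\<lambda>n t. x0 + (\<Sum>i<n. Y (Suc i) t - Y i t)) y sequentially"
    unfolding y_def by (intro uniform_limit_add uniform_limit_const ser)
  moreover have "(\<lambda>n t. x0 + (\<Sum>i<n. Y (Suc i) t - Y i t)) = Y"
    using sum_lessThan_telescope[of "\<lambda>i. Y i t" for t] by (intro ext) (simp add: Y0)
  ultimately have lim: "uniform_limit {0..T} Y y sequentially" by simp
  have ptw: "(\<lambda>n. Y n t) \<longlonglongrightarrow> y t" if "t \<in> {0..T}" for t
    using lim that by (rule tendsto_uniform_limitI)
  have yin: "y t \<in> cball x0 R" if "t \<in> {0..T}" for t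
    by (rule closed_sequentially[OF closed_cball Yin[OF that] ptw[OF that]])
  have glim: "uniform_limit {0..T} (\<lambda>n t. g (Y n t)) (\<lambda>t. g (y t)) sequentially"
    by (rule uniform_limit_compose_uniformly_continuous_on[OF
          lim lipschitz_on_uniformly_continuous[OF lip] _ closed_cball]) (use Yin in auto)
  \<comment> \<open>The index is shifted because \<open>Y (Suc n)\<close> has derivative
    \<open>g (Y n t)\<close>. These derivatives converge uniformly to \<open>g (y t)\<close>, so
    limit and derivative may be interchanged; the required convergence at one point is taken at 0,
    where every iterate equals \<open>x0\<close>.\<close>
  have "\<exists>z. \<forall>t\<in>{0..T}. (\<lambda>n. Y (Suc n) t) \<longlonglongrightarrow> z t \<and>
      (z has_derivative (\<lambda>h. h *\<^sub>R g (y t))) (at t within {0..T})"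
  proof (rule has_derivative_sequence)
    show "(Y (Suc n) has_derivative (\<lambda>h. h *\<^sub>R g (Y n t))) (at t within {0..T})"
      if "t \<in> {0..T}" for n t
      using Yder[OF that] by (simp add: has_vector_derivative_def)
    show "\<forall>\<^sub>F n in sequentially. \<forall>t\<in>{0..T}. \<forall>h.
        norm (h *\<^sub>R g (Y n t) - h *\<^sub>R g (y t)) \<le> e * norm h" if "0 < e" for e
      using uniform_limitD[OF glim that]
      by eventually_elim
        (auto simp: dist_norm mult.commute[of e] simp flip: scaleR_diff_right
          intro!: mult_left_mono intro: less_imp_le)
    show "(0::real) \<in> {0..T}" using \<open>0 \<le> T\<close> by simp
    show "(\<lambda>n. Y (Suc n) 0) \<longlonglongrightarrow> x0" by (simp add: Y_init)
  qed simp
  then obtain z where z: "\<And>t. t \<in> {0..T} \<Longrightarrow> (\<lambda>n. Y (Suc n) t) \<longlonglongrightarrow> z t"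
    "\<And>t. t \<in> {0..T} \<Longrightarrow> (z has_vector_derivative g (y t)) (at t within {0..T})"
    unfolding has_vector_derivative_def by blast
  have zy: "z t = y t" if "t \<in> {0..T}" for t
    using LIMSEQ_unique[OF z(1)[OF that]] LIMSEQ_Suc[OF ptw[OF that]] by auto
  show thesis
  proof (rule that[of z])
    show "z 0 = x0"
      using LIMSEQ_unique[OF z(1)[of 0], of x0] \<open>0 \<le> T\<close> by (simp add: Y_init)
  qed (use z(2) zy yin in auto)
qed

section \<open>Inverse operators and the continuous Newton flow\<close>

lemma blinfun_inv_eqI:
  assumes "is_blinfun_inverse A B"
  shows "blinfun_inv A = B"
  unfolding blinfun_inv_def
proof (rule the_equality)
  fix C assume C: "is_blinfun_inverse A C"
  have "C x = B x" for x
  proof -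
    have "C (A (B x)) = B x" "A (B x) = x"
      using assms C unfolding is_blinfun_inverse_def
      by (metis blinfun_apply_blinfun_compose blinfun_apply_id_blinfun)+
    then show ?thesis by simp
  qed
  then show "C = B" by (rule blinfun_eqI)
qed (fact assms)

text \<open>The resolvent-type identity \<open>B u - B v = B u (A v - A u) B v\<close> transfers
  Lipschitz continuity from operators to their inverses; the two outer factors contribute
  \<open>m\<close> each.\<close>

lemma is_blinfun_inverse_lipschitz_on:
  fixes A B :: "'a::real_normed_vector \<Rightarrow> ('a \<Rightarrow>\<^sub>L 'a)"
  assumes inv: "\<And>u. u \<in> S \<Longrightarrow> is_blinfun_inverse (A u) (B u)"
    and bd: "\<And>u. u \<in> S \<Longrightarrow> norm (B u) \<le> m"
    and lip: "L-lipschitz_on S A" and "0 \<le> m"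
  shows "(m * L * m)-lipschitz_on S B"
proof (rule lipschitz_onI)
  have "0 \<le> L" using lip by (rule lipschitz_on_nonneg)
  then show "0 \<le> m * L * m" using \<open>0 \<le> m\<close> by simp
  fix u v assume uv: "u \<in> S" "v \<in> S"
  have "B u - B v = B u o\<^sub>L ((A v - A u) o\<^sub>L B v)"
  proof (rule blinfun_eqI)
    fix x
    have "A v (B v x) = x" "B u (A u (B v x)) = B v x"
      using inv[OF uv(1)] inv[OF uv(2)] unfolding is_blinfun_inverse_def
      by (metis blinfun_apply_blinfun_compose blinfun_apply_id_blinfun)+
    then show "(B u - B v) x = (B u o\<^sub>L ((A v - A u) o\<^sub>L B v)) x"
      by (simp add: blinfun.bilinear_simps)
  qed
  then have "norm (B u - B v) \<le> norm (B u) * norm ((A v - A u) o\<^sub>L B v)"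
    by (simp add: norm_blinfun_compose)
  also have "\<dots> \<le> norm (B u) * (norm (A v - A u) * norm (B v))"
    by (intro mult_left_mono norm_blinfun_compose) simp
  also have "\<dots> \<le> m * ((L * norm (v - u)) * m)"
    using uv \<open>0 \<le> m\<close> \<open>0 \<le> L\<close>
    by (intro mult_mono bd lipschitz_on_normD[OF lip]) auto
  finally show "dist (B u) (B v) \<le> m * L * m * dist u v"
    by (simp add: dist_norm norm_minus_commute mult_ac)
qed

text \<open>Freezing \<Phi> at the initial value turns the Newton field into \<open>g\<close>, which
  is bounded by \<open>m * norm (\<Phi> x0)\<close> everywhere. In rescaled time, which runs only
  through a unit interval, the motion therefore stays in one ball, and a Lipschitz bound for
  \<open>A\<close> on that ball suffices.\<close>

lemma continuous_newton_method:
  fixes \<Phi> :: "'a::banach \<Rightarrow> 'a" and A B :: "'a \<Rightarrow> ('a \<Rightarrow>\<^sub>L 'a)"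
  assumes \<Phi>: "\<And>u. (\<Phi> has_derivative A u) (at u)"
    and inv: "\<And>u. is_blinfun_inverse (A u) (B u)"
    and bd: "\<And>u. norm (B u) \<le> m"
    and lip: "\<And>r. \<exists>L. L-lipschitz_on (cball x0 r) A"
  shows "\<exists>w. global_solution (\<lambda>u. - B u (\<Phi> u)) x0 w \<and>
           (\<forall>v. global_solution (\<lambda>u. - B u (\<Phi> u)) x0 v \<longrightarrow> (\<forall>t\<ge>0. v t = w t)) \<and>
           (\<exists>w_inf. (w \<longlongrightarrow> w_inf) at_top \<and> \<Phi> w_inf = 0)"
proof -
  have "0 \<le> m" using bd[of 0] norm_ge_zero order_trans by blast
  have AB: "A u (B u x) = x" for u x
    using inv[of u] unfolding is_blinfun_inverse_def
    by (metis blinfun_apply_blinfun_compose blinfun_apply_id_blinfun)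
  \<comment> \<open>\<open>R\<close> is at once the speed bound for \<open>g\<close> and the radius
    of the ball, as the rescaled time interval has length 1.\<close>
  define R where "R = m * norm (\<Phi> x0)"
  define g where "g u = - B u (\<Phi> x0)" for u
  have "0 \<le> R" using \<open>0 \<le> m\<close> by (simp add: R_def)
  have g_bd: "norm (g u) \<le> R" for u
    unfolding g_def R_def norm_minus_cancel
    by (rule order_trans[OF norm_blinfun]) (simp add: bd mult_right_mono)
  obtain L where "L-lipschitz_on (cball x0 R) A" using lip by blast
  then have B_lip: "(m * L * m)-lipschitz_on (cball x0 R) B"
    using inv bd \<open>0 \<le> m\<close> by (intro is_blinfun_inverse_lipschitz_on)
  define K where "K = m * L * m * norm (\<Phi> x0)"
  have g_lip: "K-lipschitz_on (cball x0 R) g"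
  proof (rule lipschitz_onI)
    show "0 \<le> K" unfolding K_def using lipschitz_on_nonneg[OF B_lip] by simp
    fix u v assume uv: "u \<in> cball x0 R" "v \<in> cball x0 R"
    have "dist (g u) (g v) = norm ((B v - B u) (\<Phi> x0))"
      by (simp add: g_def dist_norm blinfun.diff_left)
    also have "\<dots> \<le> norm (B v - B u) * norm (\<Phi> x0)" by (rule norm_blinfun)
    also have "\<dots> \<le> (m * L * m * norm (v - u)) * norm (\<Phi> x0)"
      by (intro mult_right_mono lipschitz_on_normD[OF B_lip] uv) simp
    finally show "dist (g u) (g v) \<le> K * dist u v"
      by (simp add: K_def dist_norm norm_minus_commute mult_ac)
  qed
  have \<Phi>_chain: "((\<lambda>t. \<Phi> (f t)) has_vector_derivative A (f t) f') (at t within S)"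
    if "(f has_vector_derivative f') (at t within S)" for f f' t S
    using vector_derivative_diff_chain_within[OF that has_derivative_at_withinI[OF \<Phi>]]
    by (simp add: o_def)

  \<comment> \<open>Existence in rescaled time\<close>
  obtain y where y: "y 0 = x0" "\<And>s. s \<in> {0..1} \<Longrightarrow> y s \<in> cball x0 R"
    "\<And>s. s \<in> {0..1} \<Longrightarrow> (y has_vector_derivative g (y s)) (at s within {0..1})"
    using autonomous_ode_solution_exists[OF g_lip, of R 1] g_bd \<open>0 \<le> R\<close> by auto
  have \<Phi>y: "\<Phi> (y s) = (1 - s) *\<^sub>R \<Phi> x0" if s: "s \<in> {0..1}" for s
  proof -
    \<comment> \<open>Since \<open>A\<close> undoes \<open>B\<close>, the derivative of
      \<open>\<Phi> (y r)\<close> is the constant vector \<open>- \<Phi> x0\<close>.\<close>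
    obtain C where C: "\<And>r. r \<in> {0..1} \<Longrightarrow> \<Phi> (y r) + r *\<^sub>R \<Phi> x0 = C"
    proof (rule has_vector_derivative_zero_constant)
      fix r :: real assume r: "r \<in> {0..1}"
      show "((\<lambda>r. \<Phi> (y r) + r *\<^sub>R \<Phi> x0) has_vector_derivative 0) (at r within {0..1})"
        by (rule derivative_eq_intros \<Phi>_chain y(3) r refl)+ (simp add: g_def AB blinfun.minus_right)
    qed auto
    from C[of 0] C[OF s] y(1) show ?thesis by (auto simp: algebra_simps)
  qed

  \<comment> \<open>Return to the original time\<close>
  define w where "w t = y (1 - exp (- t))" for t
  have time: "1 - exp (- t) \<in> {0..1}" if "0 \<le> t" for t :: real using that by simp
  have w_der: "(w has_vector_derivative exp (- t) *\<^sub>R g (w t)) (at t within {0..})"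
    if "0 \<le> t" for t
  proof -
    have "((\<lambda>t. 1 - exp (- t)) has_vector_derivative exp (- t)) (at t within {0..})"
      by (auto intro!: derivative_eq_intros
          simp flip: has_real_derivative_iff_has_vector_derivative)
    \<comment> \<open>The image of the half-line under the time change lies in
      \<open>{0..1}\<close>, so the derivative of \<open>y\<close> within that interval suffices;
      this also covers the one-sided derivative at \<open>t = 0\<close>.\<close>
    moreover have "(y has_vector_derivative g (w t)) (at (1 - exp (- t)) within (\<lambda>t. 1 - exp (- t)) ` {0..})"
      unfolding w_def
      by (rule has_vector_derivative_within_subset[OF y(3)[OF time[OF that]]]) auto
    ultimately show ?thesis
      using vector_diff_chain_within by (force simp: w_def[abs_def] o_def)
  qed
  have w_in: "w t \<in> cball x0 R" if "0 \<le> t" for t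
    using y(2) time[OF that] by (simp add: w_def)
  have w_sol: "global_solution (\<lambda>u. - B u (\<Phi> u)) x0 w"
    unfolding global_solution_def
  proof (intro conjI allI impI)
    show "w 0 = x0" by (simp add: w_def y)
    fix t :: real assume t: "0 \<le> t"
    have "\<Phi> (w t) = exp (- t) *\<^sub>R \<Phi> x0" using \<Phi>y[OF time[OF t]] by (simp add: w_def)
    then show "(w has_vector_derivative - B (w t) (\<Phi> (w t))) (at t within {0..})"
      using w_der[OF t] by (simp add: g_def blinfun.scaleR_right)
  qed

  \<comment> \<open>Uniqueness among global solutions\<close>
  have w_unique: "v T = w T" if v: "global_solution (\<lambda>u. - B u (\<Phi> u)) x0 v" and "0 \<le> T" for v T
  proof -
    have v0: "v 0 = x0"
      and v': "\<And>t. 0 \<le> t \<Longrightarrow> (v has_vector_derivative - B (v t) (\<Phi> (v t))) (at t within {0..})"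
      using v by (auto simp: global_solution_def)
    \<comment> \<open>Along \<open>v\<close> the derivative of \<open>\<Phi> (v t)\<close> is
      \<open>- \<Phi> (v t)\<close>, so the factor \<open>exp t\<close> compensates the decay
      exactly. Hence \<open>v\<close> solves the same frozen equation as \<open>w\<close>.\<close>
    obtain C where C: "\<And>t. t \<in> {0..} \<Longrightarrow> exp t *\<^sub>R \<Phi> (v t) = C"
    proof (rule has_vector_derivative_zero_constant)
      fix t :: real assume t: "t \<in> {0..}"
      show "((\<lambda>t. exp t *\<^sub>R \<Phi> (v t)) has_vector_derivative 0) (at t within {0..})"
        using t by (auto intro!: derivative_eq_intros \<Phi>_chain v' simp: AB blinfun.minus_right)
    qed auto
    have \<Phi>v: "\<Phi> (v t) = exp (- t) *\<^sub>R \<Phi> x0" if "0 \<le> t" for t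
    proof -
      have "exp (- t) *\<^sub>R (exp t *\<^sub>R \<Phi> (v t)) = exp (- t) *\<^sub>R \<Phi> x0"
        using C[of t] C[of 0] that v0 by simp
      then show ?thesis by (simp flip: exp_add)
    qed
    have v_der: "(v has_vector_derivative exp (- t) *\<^sub>R g (v t)) (at t within {0..})"
      if "0 \<le> t" for t
      using v'[OF that] \<Phi>v[OF that] by (simp add: g_def blinfun.scaleR_right)
    \<comment> \<open>The speed of \<open>v\<close> is at most \<open>R * exp (- s)\<close>, whose
      integral over the half-line is \<open>R\<close>. Thus \<open>v\<close> cannot leave the ball
      where \<open>g\<close> is known to be Lipschitz.\<close>
    have v_in: "v t \<in> cball x0 R" if "0 \<le> t" for t
    proof -
      have "norm (v t - v 0) \<le> - R * exp (- t) - - R * exp (- 0)"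
      proof (rule norm_increment_le)
        fix s assume s: "s \<in> {0..t}"
        show "(v has_vector_derivative exp (- s) *\<^sub>R g (v s)) (at s within {0..t})"
          using s by (intro has_vector_derivative_within_subset[OF v_der]) auto
        show "((\<lambda>s. - R * exp (- s)) has_real_derivative R * exp (- s)) (at s)"
          by (auto intro!: derivative_eq_intros)
        show "norm (exp (- s) *\<^sub>R g (v s)) \<le> R * exp (- s)"
          using g_bd by (simp add: mult.commute)
      qed (use that in simp)
      also have "\<dots> \<le> R" using \<open>0 \<le> R\<close> by simp
      finally show ?thesis by (simp add: v0 dist_norm norm_minus_commute)
    qed
    have "v T - w T = 0"
    proof (rule zero_if_norm_derivative_le[of T K "\<lambda>t. v t - w t"])
      show "0 \<le> K" using g_lip by (rule lipschitz_on_nonneg)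
      fix t assume t: "t \<in> {0..T}"
      show "((\<lambda>t. v t - w t) has_vector_derivative exp (- t) *\<^sub>R g (v t) - exp (- t) *\<^sub>R g (w t))
          (at t within {0..T})"
        using t by (intro has_vector_derivative_diff has_vector_derivative_within_subset[OF v_der]
            has_vector_derivative_within_subset[OF w_der]) auto
      have "norm (exp (- t) *\<^sub>R g (v t) - exp (- t) *\<^sub>R g (w t)) \<le> 1 * norm (g (v t) - g (w t))"
        unfolding scaleR_diff_right[symmetric] norm_scaleR using t
        by (intro mult_right_mono) auto
      also have "\<dots> \<le> K * norm (v t - w t)"
        using t by (simp add: lipschitz_on_normD[OF g_lip] v_in w_in del: mem_cball)
      finally show "norm (exp (- t) *\<^sub>R g (v t) - exp (- t) *\<^sub>R g (w t)) \<le> K * norm (v t - w t)" .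
    qed (use \<open>0 \<le> T\<close> v0 y(1) in \<open>auto simp: w_def\<close>)
    then show ?thesis by simp
  qed

  \<comment> \<open>Convergence to a zero of \<Phi>\<close>
  have y_cont: "continuous_on {0..1} y"
    using y(3) by (meson continuous_on_eq_continuous_within has_vector_derivative_continuous)
  have time_lim: "((\<lambda>t::real. 1 - exp (- t)) \<longlongrightarrow> 1) at_top"
    using tendsto_diff[OF tendsto_const[of 1] filterlim_compose[OF exp_at_bot filterlim_uminus_at_bot_at_top]]
    by simp
  have "\<forall>\<^sub>F t::real in at_top. 1 - exp (- t) \<in> {0..1}"
    using eventually_ge_at_top[of 0] by eventually_elim (rule time)
  \<comment> \<open>Infinite time corresponds to the endpoint 1 of the rescaled interval, where
    \<open>y\<close> is already defined and continuous, so the limit exists by continuity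
    alone.\<close>
  then have "(w \<longlongrightarrow> y 1) at_top"
    unfolding w_def by (rule continuous_on_tendsto_compose[OF y_cont time_lim, rotated]) simp
  moreover have "\<Phi> (y 1) = 0" using \<Phi>y[of 1] by simp
  ultimately show ?thesis using w_sol w_unique by blast
qed

section \<open>Application to the regularized equation\<close>

theorem mainTheorem2:
  fixes F :: "'a::banach \<Rightarrow> 'a"
    and F' :: "'a \<Rightarrow> ('a \<Rightarrow>\<^sub>L 'a)"
    and F'' :: "'a \<Rightarrow> ('a \<Rightarrow>\<^sub>L ('a \<Rightarrow>\<^sub>L 'a))"
    and u0 w0 :: 'a
    and c k \<epsilon>0 \<epsilon> :: real
  assumes F': "\<And>u. (F has_derivative blinfun_apply (F' u)) (at u)"
    and F'': "\<And>u. (F' has_derivative blinfun_apply (F'' u)) (at u)"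
    and bounds: "\<And>R. R > 0 \<Longrightarrow>
          \<exists>M1 M2. \<forall>u\<in>cball u0 R. norm (F' u) \<le> M1 \<and> norm (F'' u) \<le> M2"
    and "c > 0" and "0 < k" and "k \<le> 1" and "\<epsilon>0 > 0"
    and inv: "\<And>u \<delta>. \<delta> \<in> {0<..<\<epsilon>0} \<Longrightarrow>
          boundedly_invertible (F' u + \<delta> *\<^sub>R id_blinfun) \<and>
          norm (blinfun_inv (F' u + \<delta> *\<^sub>R id_blinfun)) \<le> c * \<delta> powr (-k)"
    and "\<epsilon> \<in> {0<..<\<epsilon>0}"
  defines "G \<equiv> \<lambda>w. - blinfun_apply (blinfun_inv (F' w + \<epsilon> *\<^sub>R id_blinfun)) (F w + \<epsilon> *\<^sub>R w)"
  shows "\<exists>w. global_solution G w0 w \<and>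
           (\<forall>v. global_solution G w0 v \<longrightarrow> (\<forall>t\<ge>0. v t = w t)) \<and>
           (\<exists>w_inf. (w \<longlongrightarrow> w_inf) at_top \<and> F w_inf + \<epsilon> *\<^sub>R w_inf = 0)"
proof -
  let ?A = "\<lambda>u. F' u + \<epsilon> *\<^sub>R id_blinfun"
  have lip: "\<exists>L. L-lipschitz_on (cball w0 r) ?A" for r
  proof -
    \<comment> \<open>The hypotheses bound the derivatives on balls about \<open>u0\<close>, while
      the flow starts at \<open>w0\<close>. The distance between the centres is added to the radius;
      the absolute value and the summand 1 keep \<open>R\<close> positive for every real
      \<open>r\<close>.\<close>
    define R where "R = \<bar>r\<bar> + dist u0 w0 + 1"
    have "R > 0" unfolding R_def by (smt (verit) zero_le_dist)
    then obtain M1 M2 where M: "\<And>u. u \<in> cball u0 R \<Longrightarrow> norm (F' u) \<le> M1 \<and> norm (F'' u) \<le> M2"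
      using bounds by blast
    have sub: "cball w0 r \<subseteq> cball u0 R"
    proof
      fix x assume "x \<in> cball w0 r"
      then show "x \<in> cball u0 R" using dist_triangle[of u0 x w0] by (simp add: R_def)
    qed
    \<comment> \<open>The mean value inequality on the convex ball turns the bound on
      \<open>F''\<close> into a Lipschitz bound for \<open>F'\<close>; the constant term
      \<open>\<epsilon> *\<^sub>R id_blinfun\<close> cancels in differences. Taking
      \<open>max M2 0\<close> makes the Lipschitz constant visibly nonnegative.\<close>
    have "norm (F' u - F' v) \<le> max M2 0 * norm (u - v)" if "u \<in> cball w0 r" "v \<in> cball w0 r" for u v
    proof (rule differentiable_bound)
      show "onorm (F'' x) \<le> max M2 0" if "x \<in> cball w0 r" for x
        using M[of x] sub that by (force simp: norm_blinfun.rep_eq)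
    qed (use that in \<open>auto intro: has_derivative_at_withinI[OF F'']\<close>)
    then show ?thesis
      by (intro exI[of _ "max M2 0"] lipschitz_onI) (auto simp: dist_norm)
  qed
  have "is_blinfun_inverse (?A u) (blinfun_inv (?A u))" for u
    using inv[OF \<open>\<epsilon> \<in> {0<..<\<epsilon>0}\<close>, of u] blinfun_inv_eqI unfolding boundedly_invertible_def by blast
  moreover have "((\<lambda>u. F u + \<epsilon> *\<^sub>R u) has_derivative ?A u) (at u)" for u
    by (auto intro!: derivative_eq_intros F' simp: blinfun.bilinear_simps)
  \<comment> \<open>With \<epsilon> fixed, \<open>c * \<epsilon> powr (- k)\<close> bounds the
    inverses independently of \<open>u\<close>, so it can serve as \<open>m\<close>.\<close>
  ultimately show ?thesis
    unfolding G_def using inv[OF \<open>\<epsilon> \<in> {0<..<\<epsilon>0}\<close>] lip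
    by (intro continuous_newton_method[where A = ?A and m = "c * \<epsilon> powr (- k)"]) auto
qed

end
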